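(* For any graph $G$ on $n$ vertices, \[ \chi_{\mathrm{vec}}(G)\cdot \mathrm{msr}(G) \geq n. \]
   Context: Graphs are finite, simple and nonempty. Let $R$ be a (finite-dimensional real) Euclidean space with inner product $\langle\cdot,\cdot\rangle$. An orthonormal representation of a graph $G$ in $R$ is a map $f: V(G)\to R$ such that every $f(v)$ is a unit vector and $\langle f(u), f(v)\rangle = 0$ for all distinct $u,v\in V(G)$ with $uv\notin E(G)$. The minimum semidefinite rank $\mathrm{msr}(G)$ is the minimum dimension of a Euclidean space $R$ such that there exists an orthonormal representation $f: V(G)\to R$ of $G$. The vector chromatic number $\chi_{\mathrm{vec}}(G)$ is the minimum $\kappa\geq 2$ (a real number) for which there exist a Euclidean space $R$ and an assignment of unit vectors $f: V(G)\to R$ such that $\langle f(u),f(v)\rangle \leq \frac{-1}{\kappa-1}$ for all edges $uv\in E(G)$. *)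

theory Defs
  imports Complex_Main "Graph_Theory.Digraph" "Jordan_Normal_Form.Matrix"
begin

text \<open>
  Finite simple graphs are rendered by the locale predicate \<^term>\<open>graph\<close>
  (finite, loopfree, symmetric digraphs without parallel arcs); adjacency is
  \<^term>\<open>u \<rightarrow>\<^bsub>G\<^esub> v\<close>. A Euclidean space of dimension \<open>d\<close> is, up to isometry,
  the coordinate space \<^term>\<open>carrier_vec d :: real vec set\<close> with the standard scalar product,
  so that the dimension can be quantified over.
\<close>

definition orthonormal_rep :: "('a, 'b) pre_digraph \<Rightarrow> nat \<Rightarrow> ('a \<Rightarrow> real vec) \<Rightarrow> bool" where
  "orthonormal_rep G d f \<longleftrightarrow>
     (\<forall>v\<in>verts G. f v \<in> carrier_vec d \<and> f v \<bullet> f v = 1) \<and>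
     (\<forall>u\<in>verts G. \<forall>v\<in>verts G. u \<noteq> v \<and> \<not> u \<rightarrow>\<^bsub>G\<^esub> v \<longrightarrow> f u \<bullet> f v = 0)"

definition msr :: "('a, 'b) pre_digraph \<Rightarrow> nat" where
  "msr G = (LEAST d. \<exists>f. orthonormal_rep G d f)"

definition vector_colouring ::
  "('a, 'b) pre_digraph \<Rightarrow> real \<Rightarrow> nat \<Rightarrow> ('a \<Rightarrow> real vec) \<Rightarrow> bool" where
  "vector_colouring G \<kappa> d f \<longleftrightarrow>
     (\<forall>v\<in>verts G. f v \<in> carrier_vec d \<and> f v \<bullet> f v = 1) \<and>
     (\<forall>u\<in>verts G. \<forall>v\<in>verts G. u \<rightarrow>\<^bsub>G\<^esub> v \<longrightarrow> f u \<bullet> f v \<le> - 1 / (\<kappa> - 1))"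

definition vector_chromatic_number :: "('a, 'b) pre_digraph \<Rightarrow> real" where
  "vector_chromatic_number G = (LEAST \<kappa>. \<kappa> \<ge> 2 \<and> (\<exists>d f. vector_colouring G \<kappa> d f))"

text \<open>
  Since \<^term>\<open>Least\<close> is unspecified when there is no minimum, the rest of this theory shows that
  both minima exist.
\<close>

lemma psd_imp_gram:
  fixes M :: "'a \<Rightarrow> 'a \<Rightarrow> real"
  assumes "finite V"
    and "\<And>u v. u \<in> V \<Longrightarrow> v \<in> V \<Longrightarrow> M u v = M v u"
    and "\<And>x. 0 \<le> (\<Sum>u\<in>V. \<Sum>v\<in>V. x u * x v * M u v)"
  shows "\<exists>f. \<forall>u\<in>V. f u \<in> carrier_vec (card V) \<and> (\<forall>v\<in>V. f u \<bullet> f v = M u v)"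
  using assms
proof (induction V arbitrary: M rule: finite_induct)
  case empty
  then show ?case by simp
next
  case (insert a V)
  note sym = insert.prems(1) and psd = insert.prems(2)
  define m where "m = M a a"
  have quad: "(\<Sum>u\<in>insert a V. \<Sum>v\<in>insert a V. x u * x v * M u v) =
     (x a)\<^sup>2 * m + 2 * x a * (\<Sum>u\<in>V. x u * M u a) + (\<Sum>u\<in>V. \<Sum>v\<in>V. x u * x v * M u v)" for x
  proof -
    have "(\<Sum>v\<in>V. x a * x v * M a v) = x a * (\<Sum>u\<in>V. x u * M u a)"
      unfolding sum_distrib_left using sym by (intro sum.cong) auto
    moreover have "(\<Sum>u\<in>V. x u * x a * M u a) = x a * (\<Sum>u\<in>V. x u * M u a)"
      unfolding sum_distrib_left by (intro sum.cong) auto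
    ultimately show ?thesis
      using insert.hyps by (simp add: sum.distrib m_def power2_eq_square algebra_simps)
  qed
  have m0: "m \<ge> 0"
    using psd[of "\<lambda>u. if u = a then 1 else 0"] unfolding quad
    using insert.hyps by (simp add: if_distrib[of "\<lambda>t. t * _"] sum.neutral cong: if_cong)
  have col0: "M u a = 0" if "m = 0" "u \<in> V" for u
  proof (rule ccontr)
    assume n: "M u a \<noteq> 0"
    define t where "t = - (M u u + 1) / (2 * M u a)"
    define x where "x = (\<lambda>w. if w = a then t else if w = u then 1 else 0 :: real)"
    have "u \<noteq> a" using that insert.hyps by auto
    have 1: "(\<Sum>w\<in>V. x w * g w) = g u" for g
    proof -
      have "(\<Sum>w\<in>V. x w * g w) = (\<Sum>w\<in>V. if w = u then g w else 0)"
        using insert.hyps by (intro sum.cong) (auto simp: x_def)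
      then show ?thesis using insert.hyps that by simp
    qed
    have "(\<Sum>v\<in>V. \<Sum>w\<in>V. x v * x w * M v w) = (\<Sum>v\<in>V. x v * (\<Sum>w\<in>V. x w * M v w))"
      by (simp add: sum_distrib_left mult.assoc)
    then have "(\<Sum>v\<in>V. \<Sum>w\<in>V. x v * x w * M v w) = M u u" by (simp add: 1)
    moreover have "x a = t" by (simp add: x_def)
    ultimately have "0 \<le> 2 * t * M u a + M u u"
      using psd[of x] unfolding quad by (simp add: 1 that)
    moreover have "2 * t * M u a = - (M u u + 1)" using n by (simp add: t_def)
    ultimately show False by simp
  qed
  define M' where "M' = (\<lambda>u v. M u v - M u a * M v a / m)"
  have "\<exists>f. \<forall>u\<in>V. f u \<in> carrier_vec (card V) \<and> (\<forall>v\<in>V. f u \<bullet> f v = M' u v)"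
  proof (rule insert.IH)
    show "M' u v = M' v u" if "u \<in> V" "v \<in> V" for u v
      using sym that by (simp add: M'_def)
    fix x :: "'a \<Rightarrow> real"
    define s where "s = (\<Sum>u\<in>V. x u * M u a)"
    define y where "y = x(a := - s / m)"
    have y: "y u = x u" if "u \<in> V" for u using that insert.hyps by (auto simp: y_def)
    have "(\<Sum>u\<in>V. y u * M u a) = s" by (simp add: y s_def)
    moreover have "(\<Sum>u\<in>V. \<Sum>v\<in>V. y u * y v * M u v) = (\<Sum>u\<in>V. \<Sum>v\<in>V. x u * x v * M u v)"
      by (simp add: y)
    moreover have "y a = - s / m" by (simp add: y_def)
    ultimately have "0 \<le> (s / m)\<^sup>2 * m - 2 * s / m * s + (\<Sum>u\<in>V. \<Sum>v\<in>V. x u * x v * M u v)"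
      using psd[of y] unfolding quad by (simp add: power2_eq_square)
    also have "(s / m)\<^sup>2 * m - 2 * s / m * s = - (s * s / m)"
      by (cases "m = 0") (simp_all add: power2_eq_square field_simps)
    also have "s * s / m = (\<Sum>u\<in>V. \<Sum>v\<in>V. x u * x v * (M u a * M v a / m))"
      unfolding s_def sum_product sum_divide_distrib by (intro sum.cong) auto
    finally show "0 \<le> (\<Sum>u\<in>V. \<Sum>v\<in>V. x u * x v * M' u v)"
      by (simp add: M'_def right_diff_distrib sum_subtractf)
  qed
  then obtain g where g: "\<And>u. u \<in> V \<Longrightarrow> g u \<in> carrier_vec (card V)"
    "\<And>u v. u \<in> V \<Longrightarrow> v \<in> V \<Longrightarrow> g u \<bullet> g v = M' u v" by blast
  define f where "f = (\<lambda>u. if u = a then vCons (sqrt m) (0\<^sub>v (card V))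
    else vCons (M u a / sqrt m) (g u))"
  have [simp]: "a \<notin> V" by fact
  have neq: "u \<in> V \<Longrightarrow> u \<noteq> a" for u by auto
  have "f u \<in> carrier_vec (card (insert a V))" if "u \<in> insert a V" for u
    using that g(1) insert.hyps by (auto simp: f_def)
  moreover have "f u \<bullet> f v = M u v" if "u \<in> insert a V" "v \<in> insert a V" for u v
  proof -
    have aa: "f a \<bullet> f a = M a a" using m0 by (simp add: f_def m_def)
    have av: "f w \<bullet> f a = M w a" "f a \<bullet> f w = M w a" if "w \<in> V" for w
      using that neq[OF that] g(1)[OF that] col0[OF _ that] m0 by (cases "m = 0"; simp add: f_def)+
    have vw: "f w \<bullet> f z = M w z" if "w \<in> V" "z \<in> V" for w z
      using that neq g m0 by (simp add: f_def M'_def)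
    show ?thesis
      using that aa av vw sym by auto
  qed
  ultimately show ?case by blast
qed

lemma gram_psd:
  fixes f :: "'a \<Rightarrow> real vec"
  assumes "\<And>v. v \<in> V \<Longrightarrow> f v \<in> carrier_vec d"
  shows "0 \<le> (\<Sum>u\<in>V. \<Sum>v\<in>V. x u * x v * (f u \<bullet> f v))"
proof -
  have "(\<Sum>u\<in>V. \<Sum>v\<in>V. x u * x v * (f u \<bullet> f v)) =
      (\<Sum>u\<in>V. \<Sum>v\<in>V. \<Sum>i<d. (x u * f u $ i) * (x v * f v $ i))"
    using carrier_vecD[OF assms]
    by (intro sum.cong refl) (auto simp: scalar_prod_def sum_distrib_left lessThan_atLeast0 intro!: sum.cong)
  also have "\<dots> = (\<Sum>u\<in>V. \<Sum>i<d. \<Sum>v\<in>V. (x u * f u $ i) * (x v * f v $ i))"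
    by (intro sum.cong refl sum.swap)
  also have "\<dots> = (\<Sum>i<d. \<Sum>u\<in>V. \<Sum>v\<in>V. (x u * f u $ i) * (x v * f v $ i))"
    by (rule sum.swap)
  also have "\<dots> = (\<Sum>i<d. (\<Sum>u\<in>V. x u * f u $ i) * (\<Sum>u\<in>V. x u * f u $ i))"
    by (simp add: sum_product)
  finally show ?thesis by (simp add: sum_nonneg)
qed

lemma unit_scalar_prod_bounded:
  fixes v w :: "real vec"
  assumes "v \<in> carrier_vec d" "w \<in> carrier_vec d" "v \<bullet> v = 1" "w \<bullet> w = 1"
  shows "\<bar>v \<bullet> w\<bar> \<le> 1"
proof -
  have c: "w \<bullet> v = v \<bullet> w" using assms by (simp add: comm_scalar_prod)
  have "0 \<le> (v + w) \<bullet> (v + w)" "0 \<le> (v - w) \<bullet> (v - w)"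
    by (simp_all add: scalar_prod_def sum_nonneg)
  then show ?thesis
    using assms c
    by (simp add: add_scalar_prod_distrib[of _ d] scalar_prod_add_distrib[of _ d]
        minus_scalar_prod_distrib[of _ d] scalar_prod_minus_distrib[of _ d])
qed

lemma finite_family_convergent_subseq:
  fixes X :: "nat \<Rightarrow> 'i \<Rightarrow> real"
  assumes "finite I" and "\<And>k i. i \<in> I \<Longrightarrow> \<bar>X k i\<bar> \<le> 1"
  shows "\<exists>r. strict_mono r \<and> (\<forall>i\<in>I. convergent (\<lambda>k. X (r k) i))"
  using assms
proof (induction I rule: finite_induct)
  case empty
  show ?case by (intro exI[of _ id]) (simp add: strict_mono_def)
next
  case (insert a I)
  then obtain r where r: "strict_mono r" "\<And>i. i \<in> I \<Longrightarrow> convergent (\<lambda>k. X (r k) i)" by auto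
  obtain s where s: "strict_mono s" "monoseq (\<lambda>k. X (r (s k)) a)"
    using seq_monosub[of "\<lambda>k. X (r k) a"] by auto
  have "Bseq (\<lambda>k. X (r (s k)) a)"
    using insert.prems by (intro BseqI'[where K = 1]) auto
  then have "convergent (\<lambda>k. X (r (s k)) a)" using s(2) by (rule Bseq_monoseq_convergent)
  moreover have "convergent (\<lambda>k. X (r (s k)) i)" if "i \<in> I" for i
    using convergent_subseq_convergent[OF r(2)[OF that] s(1)] by (simp add: o_def)
  moreover have "strict_mono (\<lambda>k. r (s k))"
    using strict_mono_o[OF r(1) s(1)] by (simp add: o_def)
  ultimately show ?case by blast
qed

lemma ex_orthonormal_rep:
  assumes "graph G"
  shows "\<exists>f. orthonormal_rep G (card (verts G)) f"
proof -
  interpret graph G by fact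
  define M where "M = (\<lambda>u v :: 'a. if u = v then 1 else 0 :: real)"
  have "0 \<le> (\<Sum>u\<in>verts G. \<Sum>v\<in>verts G. x u * x v * M u v)" for x
    by (auto intro!: sum_nonneg simp: M_def)
  from psd_imp_gram[OF finite_verts _ this] show ?thesis
    unfolding orthonormal_rep_def M_def by fastforce
qed

lemma ex_vector_colouring:
  assumes "graph G"
  shows "\<exists>\<kappa>\<ge>2. \<exists>d f. vector_colouring G \<kappa> d f"
proof -
  interpret graph G by fact
  let ?V = "verts G"
  define \<kappa> where "\<kappa> = max 2 (real (card ?V))"
  define c where "c = 1 / (\<kappa> - 1)"
  have k: "\<kappa> \<ge> 2" "real (card ?V) \<le> \<kappa>" by (auto simp: \<kappa>_def)
  have c: "c > 0" "1 + c = \<kappa> * c" using k by (auto simp: c_def field_simps)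
  define M where "M = (\<lambda>u v :: 'a. if u = v then 1 else - c)"
  have "0 \<le> (\<Sum>u\<in>?V. \<Sum>v\<in>?V. x u * x v * M u v)" for x
  proof -
    define S where "S = (\<Sum>u\<in>?V. x u)"
    define Q where "Q = (\<Sum>u\<in>?V. (x u)\<^sup>2)"
    have "x u * x v * M u v = (if u = v then (1 + c) * (x u)\<^sup>2 else 0) - c * (x u * x v)" for u v
      by (simp add: M_def power2_eq_square algebra_simps)
    then have "(\<Sum>u\<in>?V. \<Sum>v\<in>?V. x u * x v * M u v) =
        (1 + c) * Q - c * (\<Sum>u\<in>?V. \<Sum>v\<in>?V. x u * x v)"
      by (simp add: sum_subtractf Q_def sum_distrib_left)
    then have eq: "(\<Sum>u\<in>?V. \<Sum>v\<in>?V. x u * x v * M u v) = c * (\<kappa> * Q - S\<^sup>2)"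
      unfolding S_def power2_eq_square sum_product c(2) by (simp add: algebra_simps)
    have "0 \<le> (\<Sum>u\<in>?V. \<Sum>v\<in>?V. (x u - x v)\<^sup>2)" by (intro sum_nonneg) auto
    also have "\<dots> = (\<Sum>u\<in>?V. \<Sum>v\<in>?V. (x u)\<^sup>2 + (x v)\<^sup>2 - 2 * (x u * x v))"
      by (simp add: power2_diff mult.assoc)
    also have "\<dots> = 2 * (real (card ?V) * Q - S\<^sup>2)"
      unfolding S_def Q_def power2_eq_square sum_product
      by (simp add: sum.distrib sum_subtractf sum_distrib_left)
    finally have "S\<^sup>2 \<le> real (card ?V) * Q" by simp
    also have "\<dots> \<le> \<kappa> * Q" using k by (intro mult_right_mono) (auto simp: Q_def sum_nonneg)
    finally show ?thesis unfolding eq using c by simp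
  qed
  moreover have "M u v = M v u" for u v by (simp add: M_def)
  ultimately obtain f where f: "\<forall>u\<in>?V. f u \<in> carrier_vec (card ?V) \<and> (\<forall>v\<in>?V. f u \<bullet> f v = M u v)"
    using psd_imp_gram[OF finite_verts, of M] by blast
  have "u \<noteq> v" if "u \<rightarrow>\<^bsub>G\<^esub> v" for u v using that adj_not_same by auto
  then have "vector_colouring G \<kappa> (card ?V) f"
    using f by (auto simp: vector_colouring_def M_def c_def)
  with k show ?thesis by blast
qed

lemma msr_attained:
  assumes "graph G"
  shows "\<exists>f. orthonormal_rep G (msr G) f"
  unfolding msr_def using ex_orthonormal_rep[OF assms] by (rule LeastI)

lemma vector_chromatic_number_minimum:
  assumes "graph G"
  shows vector_chromatic_number_ge_2: "vector_chromatic_number G \<ge> 2"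
    and vector_chromatic_number_attained:
      "\<exists>d f. vector_colouring G (vector_chromatic_number G) d f"
    and vector_chromatic_number_le:
      "\<And>\<kappa> d f. \<kappa> \<ge> 2 \<Longrightarrow> vector_colouring G \<kappa> d f \<Longrightarrow> vector_chromatic_number G \<le> \<kappa>"
proof -
  interpret graph G by fact
  let ?V = "verts G"
  define S where "S = {\<kappa>. \<kappa> \<ge> 2 \<and> (\<exists>d f. vector_colouring G \<kappa> d f)}"
  define k0 where "k0 = Inf S"
  have ne: "S \<noteq> {}" using ex_vector_colouring[OF assms] by (auto simp: S_def)
  have bdd: "bdd_below S" by (rule bdd_belowI[of _ 2]) (auto simp: S_def)
  have low: "k0 \<le> \<kappa>" if "\<kappa> \<in> S" for \<kappa> using cInf_lower[OF that bdd] by (simp add: k0_def)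
  have k2: "k0 \<ge> 2" unfolding k0_def using ne by (intro cInf_greatest) (auto simp: S_def)
  have "\<exists>\<kappa>\<in>S. \<kappa> < k0 + inverse (real (Suc n))" for n
    using cInf_lessD[OF ne, of "k0 + inverse (real (Suc n))"] by (auto simp: k0_def)
  then obtain K where K: "\<And>n. K n \<in> S" "\<And>n. K n < k0 + inverse (real (Suc n))" by metis
  have lim: "K \<longlonglongrightarrow> k0"
  proof (rule tendsto_sandwich[of "\<lambda>_. k0" _ _ "\<lambda>n. k0 + inverse (real (Suc n))"])
    show "(\<lambda>n. k0 + inverse (real (Suc n))) \<longlonglongrightarrow> k0"
      by (rule LIMSEQ_inverse_real_of_nat_add)
    show "\<forall>\<^sub>F n in sequentially. k0 \<le> K n"
      using low[OF K(1)] by simp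
    show "\<forall>\<^sub>F n in sequentially. K n \<le> k0 + inverse (real (Suc n))"
      using less_imp_le[OF K(2)] by (intro always_eventually allI)
    show "(\<lambda>n. k0) \<longlonglongrightarrow> k0" by (rule tendsto_const)
  qed
  have "\<forall>n. \<exists>d f. vector_colouring G (K n) d f" using K(1) by (auto simp: S_def)
  then obtain d f where f: "\<And>n. vector_colouring G (K n) (d n) (f n)" by metis
  have car: "\<And>n v. v \<in> ?V \<Longrightarrow> f n v \<in> carrier_vec (d n)"
    and unit: "\<And>n v. v \<in> ?V \<Longrightarrow> f n v \<bullet> f n v = 1"
    and edge: "\<And>n u v. u \<in> ?V \<Longrightarrow> v \<in> ?V \<Longrightarrow> u \<rightarrow>\<^bsub>G\<^esub> v \<Longrightarrow> f n u \<bullet> f n v \<le> - 1 / (K n - 1)"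
    using f unfolding vector_colouring_def by blast+
  obtain r where r: "strict_mono r"
    "\<forall>p\<in>?V \<times> ?V. convergent (\<lambda>n. f (r n) (fst p) \<bullet> f (r n) (snd p))"
    using finite_family_convergent_subseq[of "?V \<times> ?V" "\<lambda>n p. f n (fst p) \<bullet> f n (snd p)"]
      unit_scalar_prod_bounded[OF car car unit unit] by auto
  define M where "M = (\<lambda>u v. lim (\<lambda>n. f (r n) u \<bullet> f (r n) v))"
  have M: "(\<lambda>n. f (r n) u \<bullet> f (r n) v) \<longlonglongrightarrow> M u v" if "u \<in> ?V" "v \<in> ?V" for u v
    using r(2) that unfolding M_def by (auto simp: convergent_LIMSEQ_iff)
  have "M u v = M v u" if "u \<in> ?V" "v \<in> ?V" for u v
    unfolding M_def using comm_scalar_prod[OF car car] that by metis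
  moreover have "0 \<le> (\<Sum>u\<in>?V. \<Sum>v\<in>?V. x u * x v * M u v)" for x
  proof (rule LIMSEQ_le_const)
    show "(\<lambda>n. \<Sum>u\<in>?V. \<Sum>v\<in>?V. x u * x v * (f (r n) u \<bullet> f (r n) v))
        \<longlonglongrightarrow> (\<Sum>u\<in>?V. \<Sum>v\<in>?V. x u * x v * M u v)"
      by (intro tendsto_sum tendsto_mult tendsto_const M)
    have "0 \<le> (\<Sum>u\<in>?V. \<Sum>v\<in>?V. x u * x v * (f (r n) u \<bullet> f (r n) v))" for n
      by (rule gram_psd[OF car])
    then show "\<exists>N. \<forall>n\<ge>N. 0 \<le> (\<Sum>u\<in>?V. \<Sum>v\<in>?V. x u * x v * (f (r n) u \<bullet> f (r n) v))"
      by blast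
  qed
  ultimately obtain g where g: "\<And>u. u \<in> ?V \<Longrightarrow> g u \<in> carrier_vec (card ?V)"
    "\<And>u v. u \<in> ?V \<Longrightarrow> v \<in> ?V \<Longrightarrow> g u \<bullet> g v = M u v"
    using psd_imp_gram[OF finite_verts, of M] by blast
  have "M v v = 1" if "v \<in> ?V" for v
    using M[OF that that] unit[OF that] by (simp add: LIMSEQ_const_iff)
  moreover have "M u v \<le> - 1 / (k0 - 1)" if "u \<in> ?V" "v \<in> ?V" "u \<rightarrow>\<^bsub>G\<^esub> v" for u v
  proof (rule LIMSEQ_le[OF M[OF that(1,2)]])
    have "(\<lambda>n. K (r n)) \<longlonglongrightarrow> k0" using LIMSEQ_subseq_LIMSEQ[OF lim r(1)] by (simp add: o_def)
    then show "(\<lambda>n. - 1 / (K (r n) - 1)) \<longlonglongrightarrow> - 1 / (k0 - 1)"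
      using k2 by (intro tendsto_intros) auto
  qed (use edge[OF that] in auto)
  ultimately have "vector_colouring G k0 (card ?V) g"
    using g by (auto simp: vector_colouring_def)
  then have in_S: "k0 \<in> S" using k2 by (auto simp: S_def)
  have "vector_chromatic_number G = k0"
    unfolding vector_chromatic_number_def
    by (rule Least_equality) (use in_S low in \<open>auto simp: S_def\<close>)
  then show "vector_chromatic_number G \<ge> 2"
    "\<exists>d f. vector_colouring G (vector_chromatic_number G) d f"
    "\<And>\<kappa> d f. \<kappa> \<ge> 2 \<Longrightarrow> vector_colouring G \<kappa> d f \<Longrightarrow> vector_chromatic_number G \<le> \<kappa>"
    using in_S low by (auto simp: S_def)
qed

end

theory Submission
  imports Defs "HOL-Analysis.Convex"
begin

text \<open>
  The argument estimates \<open>S = (\<Sum>u v. \<langle>f u, f v\<rangle>\<^sup>2)\<close> from both sides, where \<open>f\<close> is an orthonormal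
  representation in the least dimension \<open>d = msr G\<close>; \<open>g\<close> denotes an optimal vector colouring,
  with value \<open>\<kappa>\<close>.

  From below, \<open>S\<close> is the squared Frobenius norm of the frame operator \<open>A = (\<Sum>u. f u (f u)\<^sup>T)\<close>,
  a \<open>d \<times> d\<close> matrix of trace \<open>n\<close>, so that Cauchy--Schwarz on its diagonal gives \<open>n\<^sup>2 \<le> d * S\<close>
  (\<open>frame_potential_lower_bound\<close>).

  From above, the entrywise product of Gram matrices \<open>\<langle>f u, f v\<rangle>\<^sup>2 * \<langle>g u, g v\<rangle>\<close> is the
  Gram matrix of the tensors \<open>f u \<otimes> f u \<otimes> g u\<close>, so the sum of its entries is nonnegative
  (\<open>hadamard_square_gram_nonneg\<close>). Entry by entry,
  \<open>\<langle>f u, f v\<rangle>\<^sup>2 * (\<langle>g u, g v\<rangle> + 1 / (\<kappa> - 1))\<close> is nonpositive off the diagonal: on edges because the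
  second factor is, on non-edges because the first factor vanishes. Each diagonal entry is
  \<open>\<kappa> / (\<kappa> - 1)\<close>. Summing up, \<open>S / (\<kappa> - 1) \<le> n * \<kappa> / (\<kappa> - 1)\<close>, that is, \<open>S \<le> \<kappa> * n\<close>
  (\<open>frame_potential_upper_bound\<close>). Hence \<open>n\<^sup>2 \<le> d * \<kappa> * n\<close>.
\<close>

unbundle no inner_syntax

text \<open>
  The square of a scalar product is the scalar product of the tensor squares \<open>f u \<otimes> f u\<close>, whose
  coordinates are indexed by \<open>(i, j)\<close>. The weight \<open>c\<close> allows both \<open>c = 1\<close>, which gives the Frobenius
  norm of the frame operator, and \<open>c u v = \<langle>g u, g v\<rangle>\<close>, which gives the tensors \<open>f u \<otimes> f u \<otimes> g u\<close>.
\<close>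

lemma sum_scalar_prod_square_weighted:
  fixes f :: "'a \<Rightarrow> real vec"
  assumes "\<And>v. v \<in> V \<Longrightarrow> f v \<in> carrier_vec d"
  shows "(\<Sum>u\<in>V. \<Sum>v\<in>V. (f u \<bullet> f v)\<^sup>2 * c u v) =
    (\<Sum>i<d. \<Sum>j<d. \<Sum>u\<in>V. \<Sum>v\<in>V. (f u $ i * f u $ j) * (f v $ i * f v $ j) * c u v)"
proof -
  have "(f u \<bullet> f v)\<^sup>2 * c u v =
      (\<Sum>i<d. \<Sum>j<d. (f u $ i * f u $ j) * (f v $ i * f v $ j) * c u v)"
    if "u \<in> V" "v \<in> V" for u v
  proof -
    have "f u \<bullet> f v = (\<Sum>i<d. f u $ i * f v $ i)"
      using assms[OF that(2)] by (simp add: scalar_prod_def lessThan_atLeast0)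
    then have "(f u \<bullet> f v)\<^sup>2 = (\<Sum>i<d. \<Sum>j<d. (f u $ i * f v $ i) * (f u $ j * f v $ j))"
      by (simp only: power2_eq_square sum_product)
    then show ?thesis
      by (simp add: sum_distrib_left sum_distrib_right mult_ac)
  qed
  then have "(\<Sum>u\<in>V. \<Sum>v\<in>V. (f u \<bullet> f v)\<^sup>2 * c u v) =
      (\<Sum>u\<in>V. \<Sum>v\<in>V. \<Sum>i<d. \<Sum>j<d. (f u $ i * f u $ j) * (f v $ i * f v $ j) * c u v)"
    by simp
  also have "\<dots> = (\<Sum>u\<in>V. \<Sum>i<d. \<Sum>j<d. \<Sum>v\<in>V. (f u $ i * f u $ j) * (f v $ i * f v $ j) * c u v)"
    by (simp only: sum.swap[of _ "{..<d}" V])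
  also have "\<dots> = (\<Sum>i<d. \<Sum>j<d. \<Sum>u\<in>V. \<Sum>v\<in>V. (f u $ i * f u $ j) * (f v $ i * f v $ j) * c u v)"
    by (simp only: sum.swap[of _ "{..<d}" V])
  finally show ?thesis .
qed

lemma hadamard_square_gram_nonneg:
  fixes f g :: "'a \<Rightarrow> real vec"
  assumes "\<And>v. v \<in> V \<Longrightarrow> f v \<in> carrier_vec d" and "\<And>v. v \<in> V \<Longrightarrow> g v \<in> carrier_vec e"
  shows "0 \<le> (\<Sum>u\<in>V. \<Sum>v\<in>V. (f u \<bullet> f v)\<^sup>2 * (g u \<bullet> g v))"
proof -
  have "0 \<le> (\<Sum>u\<in>V. \<Sum>v\<in>V. (f u $ i * f u $ j) * (f v $ i * f v $ j) * (g u \<bullet> g v))" for i j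
    using gram_psd[OF assms(2), where x = "\<lambda>u. f u $ i * f u $ j"] .
  then show ?thesis
    using sum_scalar_prod_square_weighted[of V f d "\<lambda>u v. g u \<bullet> g v", OF assms(1)]
    by (simp add: sum_nonneg)
qed

text \<open>
  With \<open>A = (\<Sum>u. f u (f u)\<^sup>T)\<close>, the squared Frobenius norm is at least the sum of the squared
  diagonal entries, and these \<open>d\<close> entries add up to the trace \<open>(\<Sum>u. \<langle>f u, f u\<rangle>) = card V\<close>.
  This is the Welch bound.
\<close>

lemma frame_potential_lower_bound:
  fixes f :: "'a \<Rightarrow> real vec"
  assumes "\<And>v. v \<in> V \<Longrightarrow> f v \<in> carrier_vec d" and "\<And>v. v \<in> V \<Longrightarrow> f v \<bullet> f v = 1"
  shows "(real (card V))\<^sup>2 \<le> real d * (\<Sum>u\<in>V. \<Sum>v\<in>V. (f u \<bullet> f v)\<^sup>2)"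
proof -
  define A where "A i j = (\<Sum>u\<in>V. f u $ i * f u $ j)" for i j
  have "real (card V) = (\<Sum>u\<in>V. f u \<bullet> f u)"
    using assms(2) by simp
  also have "\<dots> = (\<Sum>u\<in>V. \<Sum>i<d. f u $ i * f u $ i)"
    using carrier_vecD[OF assms(1)] by (simp add: scalar_prod_def lessThan_atLeast0)
  also have "\<dots> = (\<Sum>i<d. A i i)"
    unfolding A_def by (rule sum.swap)
  finally have trace: "real (card V) = (\<Sum>i<d. A i i)" .
  have "(\<Sum>i<d. A i i)\<^sup>2 \<le> real d * (\<Sum>i<d. (A i i)\<^sup>2)"
    using sum_squared_le_sum_of_squares[of "\<lambda>i. A i i" "{..<d}"] by (simp add: mult.commute)
  also have "\<dots> \<le> real d * (\<Sum>i<d. \<Sum>j<d. (A i j)\<^sup>2)"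
    by (intro mult_left_mono sum_mono member_le_sum) auto
  also have "(\<Sum>i<d. \<Sum>j<d. (A i j)\<^sup>2) = (\<Sum>u\<in>V. \<Sum>v\<in>V. (f u \<bullet> f v)\<^sup>2)"
    using sum_scalar_prod_square_weighted[of V f d "\<lambda>_ _. 1", OF assms(1)]
    by (simp add: A_def power2_eq_square sum_product)
  finally show ?thesis unfolding trace .
qed

lemma frame_potential_upper_bound:
  assumes "finite (verts G)" and "orthonormal_rep G d f"
    and "vector_colouring G \<kappa> e g" and "\<kappa> > 1"
  shows "(\<Sum>u\<in>verts G. \<Sum>v\<in>verts G. (f u \<bullet> f v)\<^sup>2) \<le> \<kappa> * real (card (verts G))"
proof -
  let ?V = "verts G"
  define S where "S = (\<Sum>u\<in>?V. \<Sum>v\<in>?V. (f u \<bullet> f v)\<^sup>2)"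
  define c where "c = 1 / (\<kappa> - 1)"
  have c: "c > 0" "1 + c = c * \<kappa>"
    using assms(4) by (auto simp: c_def field_simps)
  have entry: "(f u \<bullet> f v)\<^sup>2 * (g u \<bullet> g v + c) \<le> (if u = v then 1 + c else 0)"
    if "u \<in> ?V" "v \<in> ?V" for u v
  proof -
    consider "u = v" | "u \<noteq> v" "\<not> u \<rightarrow>\<^bsub>G\<^esub> v" | "u \<noteq> v" "u \<rightarrow>\<^bsub>G\<^esub> v" by blast
    then show ?thesis
    proof cases
      case 1
      then show ?thesis
        using that assms(2,3) by (simp add: orthonormal_rep_def vector_colouring_def)
    next
      case 2
      then have "f u \<bullet> f v = 0"
        using that assms(2) by (simp add: orthonormal_rep_def)
      with 2 show ?thesis by simp
    next
      case 3
      then have "g u \<bullet> g v + c \<le> 0"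
        using that assms(3) by (force simp: vector_colouring_def c_def)
      with 3 show ?thesis by (simp add: mult_nonneg_nonpos)
    qed
  qed
  have "0 \<le> (\<Sum>u\<in>?V. \<Sum>v\<in>?V. (f u \<bullet> f v)\<^sup>2 * (g u \<bullet> g v))"
    using assms(2,3) unfolding orthonormal_rep_def vector_colouring_def
    by (intro hadamard_square_gram_nonneg) blast+
  then have "c * S \<le> (\<Sum>u\<in>?V. \<Sum>v\<in>?V. (f u \<bullet> f v)\<^sup>2 * (g u \<bullet> g v + c))"
    by (simp add: S_def distrib_left sum.distrib sum_distrib_left mult.commute[of c])
  also have "\<dots> \<le> (\<Sum>u\<in>?V. \<Sum>v\<in>?V. if u = v then 1 + c else 0)"
    by (intro sum_mono entry)
  also have "\<dots> = c * (\<kappa> * real (card ?V))"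
    using assms(1) c(2) by (simp add: mult_ac)
  finally show ?thesis
    using c(1) by (simp add: S_def)
qed

theorem theorem10:
  fixes G :: "('a, 'b) pre_digraph" and n :: nat
  assumes "graph G" and "verts G \<noteq> {}" and "card (verts G) = n"
  shows "vector_chromatic_number G * real (msr G) \<ge> real n"
proof -
  interpret graph G by fact
  define \<kappa> where "\<kappa> = vector_chromatic_number G"
  define S where "S f = (\<Sum>u\<in>verts G. \<Sum>v\<in>verts G. (f u \<bullet> f v)\<^sup>2)" for f :: "'a \<Rightarrow> real vec"
  obtain f where f: "orthonormal_rep G (msr G) f"
    using msr_attained[OF assms(1)] by blast
  obtain d g where g: "vector_colouring G \<kappa> d g"
    using vector_chromatic_number_attained[OF assms(1)] unfolding \<kappa>_def by blast
  have "\<kappa> > 1"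
    using vector_chromatic_number_ge_2[OF assms(1)] by (simp add: \<kappa>_def)
  have "real n * real n \<le> real (msr G) * S f"
    using frame_potential_lower_bound[of "verts G" f "msr G"] f assms(3)
    unfolding orthonormal_rep_def S_def power2_eq_square by blast
  also have "\<dots> \<le> real (msr G) * (\<kappa> * real n)"
    using frame_potential_upper_bound[OF finite_verts f g \<open>\<kappa> > 1\<close>] assms(3)
    unfolding S_def by (intro mult_left_mono) auto
  finally have "real n * real n \<le> (\<kappa> * real (msr G)) * real n"
    by (simp add: mult_ac)
  moreover have "real n > 0"
    using assms(2,3) finite_verts by auto
  ultimately show ?thesis
    unfolding \<kappa>_def by simp
qed

end
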